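(* There is a tree $T$ on $2\times 2$ with acyclic levels such that for each countable ordinal $\xi<\omega_1$ there is a set $S_{1+\xi}\in\mathbf{\Sigma}^0_{1+\xi}([T])$ which is not $\mathrm{pot}(\mathbf{\Pi}^0_{1+\xi})$ (as a subset of $2^\omega\times 2^\omega$).
   Context: A Borel set $A\subseteq X\times Y$ ($X,Y$ Polish) is $\mathrm{pot}(\Gamma)$ if there are Polish topologies $\sigma$ on $X$ and $\tau$ on $Y$, finer than the original ones, with $A\in\Gamma([X,\sigma]\times[Y,\tau])$. A tree $T$ on $2\times 2$ is a set of pairs $(s,t)\in\bigcup_{p\in\omega}2^p\times 2^p$ closed under restrictions; $[T]$ is the set of $(\alpha,\beta)\in 2^\omega\times 2^\omega$ with $(\alpha\upharpoonright p,\beta\upharpoonright p)\in T$ for all $p$. For $p\in\omega$ let $\mathcal T_p:=T\cap(2^p\times 2^p)$ and let $G_{\mathcal T_p}$ be the bipartite graph with vertex set $\{(s,0):s\in 2^p\}\cup\{(t,1):t\in 2^p\}$ and edges $\{(s,0),(t,1)\}$ for $(s,t)\in\mathcal T_p$. $T$ has acyclic levels if every $G_{\mathcal T_p}$ is acyclic. *)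

theory Defs
  imports "HOL-Analysis.Analysis"
begin

definition Polish_space :: "'a topology \<Rightarrow> bool" where
  "Polish_space X \<longleftrightarrow> completely_metrizable_space X \<and> separable_space X"

definition finer_topology :: "'a topology \<Rightarrow> 'a topology \<Rightarrow> bool" where
  "finer_topology \<sigma> X \<longleftrightarrow> topspace \<sigma> = topspace X \<and> (\<forall>U. openin X U \<longrightarrow> openin \<sigma> U)"

definition cantor_space :: "(nat \<Rightarrow> bool) topology" where
  "cantor_space = product_topology (\<lambda>_. discrete_topology (UNIV :: bool set)) UNIV"

text \<open>A countable ordinal xi is represented by a well-order r on a subset of nat
  (xi = order type of r).  The ordinals eta < xi are the order types of the
  initial segments Restr r (underS r a), a in Field r.
  Sigma0_cls X r A means A is Sigma^0_{1+xi}(X): for xi = 0 the open sets, for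
  xi > 0 countable unions of Pi^0_{1+eta} sets with eta < xi.\<close>

inductive Sigma0_cls :: "'a topology \<Rightarrow> nat rel \<Rightarrow> 'a set \<Rightarrow> bool" where
  Sigma0_cls_open: "openin X A \<Longrightarrow> Sigma0_cls X {} A"
| Sigma0_cls_union: "r \<noteq> {} \<Longrightarrow>
     (\<And>n::nat. B n \<subseteq> topspace X \<and>
           (\<exists>a\<in>Field r. Sigma0_cls X (Restr r (underS r a)) (topspace X - B n)))
     \<Longrightarrow> Sigma0_cls X r (\<Union>n. B n)"

definition Pi0_cls :: "'a topology \<Rightarrow> nat rel \<Rightarrow> 'a set \<Rightarrow> bool" where
  "Pi0_cls X r A \<longleftrightarrow> A \<subseteq> topspace X \<and> Sigma0_cls X r (topspace X - A)"

definition pot :: "(('a \<times> 'b) topology \<Rightarrow> ('a \<times> 'b) set \<Rightarrow> bool) \<Rightarrow> 'a topology \<Rightarrow> 'b topology \<Rightarrow> ('a \<times> 'b) set \<Rightarrow> bool" where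
  "pot \<Gamma> X Y A \<longleftrightarrow> (\<exists>\<sigma> \<tau>. Polish_space \<sigma> \<and> Polish_space \<tau> \<and>
      finer_topology \<sigma> X \<and> finer_topology \<tau> Y \<and> \<Gamma> (prod_topology \<sigma> \<tau>) A)"

definition is_tree22 :: "(bool list \<times> bool list) set \<Rightarrow> bool" where
  "is_tree22 T \<longleftrightarrow> (\<forall>(s,t)\<in>T. length s = length t) \<and>
     (\<forall>s t p. (s,t) \<in> T \<and> p \<le> length s \<longrightarrow> (take p s, take p t) \<in> T)"

definition body :: "(bool list \<times> bool list) set \<Rightarrow> ((nat \<Rightarrow> bool) \<times> (nat \<Rightarrow> bool)) set" where
  "body T = {(\<alpha>,\<beta>). \<forall>p. (map \<alpha> [0..<p], map \<beta> [0..<p]) \<in> T}"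

text \<open>The bipartite graph G_{T_p}: vertices (s,False) (s in 2^p, left copy) and
  (t,True) (t in 2^p, right copy); edge {(s,False),(t,True)} iff (s,t) in T, |s| = p.\<close>

definition level_graph_edge :: "(bool list \<times> bool list) set \<Rightarrow> nat \<Rightarrow>
    (bool list \<times> bool) \<Rightarrow> (bool list \<times> bool) \<Rightarrow> bool" where
  "level_graph_edge T p x y \<longleftrightarrow> (\<exists>s t. (s,t) \<in> T \<and> length s = p \<and> length t = p \<and>
     ((x = (s,False) \<and> y = (t,True)) \<or> (x = (t,True) \<and> y = (s,False))))"

definition acyclic_graph :: "('v \<Rightarrow> 'v \<Rightarrow> bool) \<Rightarrow> bool" where
  "acyclic_graph E \<longleftrightarrow> \<not> (\<exists>vs. length vs \<ge> 3 \<and> distinct vs \<and>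
     (\<forall>i < length vs. E (vs ! i) (vs ! ((i + 1) mod length vs))))"

definition acyclic_levels :: "(bool list \<times> bool list) set \<Rightarrow> bool" where
  "acyclic_levels T \<longleftrightarrow> (\<forall>p. acyclic_graph (level_graph_edge T p))"

end

(*
  The two branches of a pair in [T] may differ at position l only by the bits (0,1), and only right
  after a prescribed pair (sL l, tL l). So level l + 1 is two copies of level l joined by at most one
  edge, which gives acyclicity. Each l carries a label lab l, and the prescribed pairs are dense with
  every label. The set D of labels of the positions where a pair in [T] differs can be any set of
  naturals, and "k is in D" is an open condition on the pair.

  There are sets H_xi of subsets of a countable set (hard below) that are Sigma^0_{1+xi} already for
  the topology generated by the conditions "k is in D", but are not Pi^0_{1+xi} in Cantor space, by
  diagonalisation. So S = {D in H_xi} is Sigma^0_{1+xi} in [T]. Conversely, given finer Polish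
  topologies, a fusion through pairs of sets that are nonmeager in every subcylinder yields a map
  f from Cantor space to [T], continuous for the finer topologies, such that D (f g) = g. Hence S
  being Pi^0_{1+xi} for the finer topologies would make H_xi itself Pi^0_{1+xi}.
*)
theory Submission
  imports Defs
begin

subsection \<open>A hard set at every level of the Borel hierarchy\<close>

definition cyl :: "bool list \<Rightarrow> (nat \<Rightarrow> bool) set" where
  "cyl s = {x. \<forall>i<length s. x i = s ! i}"

lemma topspace_cantor [simp]: "topspace cantor_space = UNIV"
  by (simp add: cantor_space_def)

lemma cyl_map: "cyl (map x [0..<n]) = {y. \<forall>i<n. y i = x i}"
  by (auto simp: cyl_def)

lemma openin_cyl: "openin cantor_space (cyl s)"
proof -
  have "cyl s = PiE UNIV (\<lambda>i. if i < length s then {s ! i} else UNIV)"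
    by (auto simp: cyl_def PiE_def Pi_def extensional_def split: if_splits)
  moreover have "finite {i::nat. (if i < length s then {s ! i} else UNIV) \<noteq> UNIV}"
    by (rule finite_subset[of _ "{..<length s}"]) auto
  ultimately show ?thesis
    unfolding cantor_space_def by (simp add: openin_PiE_gen)
qed

lemma openin_cantor:
  "openin cantor_space U \<longleftrightarrow> (\<forall>x\<in>U. \<exists>n. cyl (map x [0..<n]) \<subseteq> U)"
proof
  assume L: "openin cantor_space U"
  show "\<forall>x\<in>U. \<exists>n. cyl (map x [0..<n]) \<subseteq> U"
  proof
    fix x assume "x \<in> U"
    with L obtain V where V: "finite {i. V i \<noteq> UNIV}" "x \<in> PiE UNIV V" "PiE UNIV V \<subseteq> U"
      unfolding cantor_space_def openin_product_topology_alt by auto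
    obtain n where n: "\<And>i. V i \<noteq> UNIV \<Longrightarrow> i < n"
      using V(1) by (metis (mono_tags, lifting) finite_nat_set_iff_bounded mem_Collect_eq)
    have "y \<in> PiE UNIV V" if "\<forall>i<n. y i = x i" for y
    proof -
      have "y i \<in> V i" for i
        using that n[of i] V(2) by (cases "V i = UNIV") (auto simp: PiE_iff)
      then show ?thesis by auto
    qed
    then show "\<exists>n. cyl (map x [0..<n]) \<subseteq> U"
      using V(3) unfolding cyl_map by (intro exI[of _ n]) blast
  qed
next
  assume R: "\<forall>x\<in>U. \<exists>n. cyl (map x [0..<n]) \<subseteq> U"
  have "\<exists>T. openin cantor_space T \<and> x \<in> T \<and> T \<subseteq> U" if x: "x \<in> U" for x
  proof -
    obtain n where "cyl (map x [0..<n]) \<subseteq> U" using R x by blast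
    moreover have "x \<in> cyl (map x [0..<n])" by (simp add: cyl_map)
    ultimately show ?thesis using openin_cyl by blast
  qed
  then show "openin cantor_space U"
    using openin_subopen[of cantor_space U] by meson
qed

text \<open>Preimages commute with countable unions, and with complements because f maps
  \<open>topspace X\<close> into \<open>topspace Y\<close>; the induction follows the build-up of
  the class.\<close>

lemma Sigma0_cls_preimage:
  assumes "Sigma0_cls Y r A" and "continuous_map X Y f"
  shows "Sigma0_cls X r {x \<in> topspace X. f x \<in> A}"
  using assms
proof (induction)
  case (Sigma0_cls_open Y A)
  then show ?case
    by (intro Sigma0_cls.Sigma0_cls_open) (simp add: openin_continuous_map_preimage)
next
  case (Sigma0_cls_union r B Y)
  have "Sigma0_cls X r (\<Union>n. {x \<in> topspace X. f x \<in> B n})"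
  proof (intro Sigma0_cls.Sigma0_cls_union conjI)
    fix n
    obtain a where a: "a \<in> Field r"
      "Sigma0_cls X (Restr r (underS r a)) {x \<in> topspace X. f x \<in> topspace Y - B n}"
      using Sigma0_cls_union.IH[of n] Sigma0_cls_union.prems by blast
    moreover have "topspace X - {x \<in> topspace X. f x \<in> B n} = {x \<in> topspace X. f x \<in> topspace Y - B n}"
      using continuous_map_image_subset_topspace[OF Sigma0_cls_union.prems] by auto
    ultimately show "\<exists>a\<in>Field r. Sigma0_cls X (Restr r (underS r a)) (topspace X - {x \<in> topspace X. f x \<in> B n})"
      by auto
  qed (use Sigma0_cls_union.hyps(1) in auto)
  also have "(\<Union>n. {x \<in> topspace X. f x \<in> B n}) = {x \<in> topspace X. f x \<in> (\<Union>n. B n)}"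
    by auto
  finally show ?case .
qed

lemma Pi0_cls_preimage:
  assumes "Pi0_cls Y r A" and f: "continuous_map X Y f"
  shows "Pi0_cls X r {x \<in> topspace X. f x \<in> A}"
proof -
  have "topspace X - {x \<in> topspace X. f x \<in> A} = {x \<in> topspace X. f x \<in> topspace Y - A}"
    using continuous_map_image_subset_topspace[OF f] by auto
  moreover have "Sigma0_cls X r \<dots>"
    using assms(1) by (intro Sigma0_cls_preimage[OF _ f]) (simp add: Pi0_cls_def)
  ultimately show ?thesis
    unfolding Pi0_cls_def by auto
qed

section \<open>Borel codes and universal sets at every level\<close>

type_synonym index = "(nat \<times> nat) list \<times> bool list"

text \<open>The list in an \<open>index\<close> records the pairs (a, i) chosen while descending to
  lower levels, and the bit list names a cylinder. A section is the subcode reached by the first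
  choice (a, i).\<close>

definition sec :: "nat \<Rightarrow> nat \<Rightarrow> (index \<Rightarrow> bool) \<Rightarrow> index \<Rightarrow> bool" where
  "sec a i x = (\<lambda>(js, s). x ((a, i) # js, s))"

text \<open>Right inverse to taking sections: it assembles a code from prescribed subcodes. Entries
  with an empty list belong to no subcode, and \<open>False\<close> is a default value
  there.\<close>

definition join :: "(nat \<Rightarrow> nat \<Rightarrow> index \<Rightarrow> bool) \<Rightarrow> index \<Rightarrow> bool" where
  "join E = (\<lambda>(js, s). case js of [] \<Rightarrow> False | (a, i) # js' \<Rightarrow> E a i (js', s))"

text \<open>This makes e a Borel code: \<open>hard r (trace e x)\<close> will say that x belongs to
  the set of level r coded by e.\<close>

definition trace :: "(index \<Rightarrow> bool) \<Rightarrow> (nat \<Rightarrow> bool) \<Rightarrow> index \<Rightarrow> bool" where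
  "trace e x = (\<lambda>(js, s). e (js, s) \<and> x \<in> cyl s)"

definition decode :: "(nat \<Rightarrow> bool) \<Rightarrow> index \<Rightarrow> bool" where
  "decode x p = x (to_nat p)"

lemma sec_join [simp]: "sec a i (join E) = E a i"
  by (auto simp: sec_def join_def)

lemma sec_trace [simp]: "sec a i (trace e x) = trace (sec a i e) x"
  by (auto simp: sec_def trace_def fun_eq_iff)

lemma surj_decode: "\<exists>x. decode x = e"
  by (rule exI[of _ "\<lambda>k. e (from_nat k)"]) (simp add: decode_def fun_eq_iff)

text \<open>The recursion mirrors \<open>Sigma0_cls\<close>: an open condition at the bottom, and
  above it a countable union of complements from lower levels. The value \<open>False\<close> away
  from well-orders secures termination, which runs along \<open>ordLess\<close>.\<close>

function hard :: "nat rel \<Rightarrow> (index \<Rightarrow> bool) \<Rightarrow> bool" where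
  "hard r x = (if r = {} then \<exists>p. x p
     else if Well_order r
       then \<exists>a\<in>Field r. \<exists>i. \<not> hard (Restr r (underS r a)) (sec a i x)
       else False)"
  by pat_completeness auto
termination
proof (relation "inv_image ordLess fst")
  show "wf (inv_image ordLess fst :: ((nat rel \<times> (index \<Rightarrow> bool)) \<times> _) set)"
    by (rule wf_inv_image) (rule wf_ordLess)
qed (auto intro!: underS_Restr_ordLess)

declare hard.simps [simp del]

lemma hard_empty [simp]: "hard {} x \<longleftrightarrow> (\<exists>p. x p)"
  by (simp add: hard.simps)

lemma hard_nonempty:
  "Well_order r \<Longrightarrow> r \<noteq> {} \<Longrightarrow>
    hard r x \<longleftrightarrow> (\<exists>a\<in>Field r. \<exists>i. \<not> hard (Restr r (underS r a)) (sec a i x))"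
  by (subst hard.simps) simp

text \<open>Proper initial segments are smaller for \<open>ordLess\<close>, so its well-foundedness
  gives an induction in the shape of the recursion of \<open>hard\<close>.\<close>

lemma Well_order_underS_induct [consumes 1, case_names empty step]:
  fixes r :: "'a rel"
  assumes "Well_order r"
    and "P {}"
    and "\<And>r. Well_order r \<Longrightarrow> r \<noteq> {} \<Longrightarrow> (\<And>a. a \<in> Field r \<Longrightarrow> P (Restr r (underS r a))) \<Longrightarrow> P r"
  shows "P r"
  using wf_ordLess assms(1)
proof (induction r rule: wf_induct_rule)
  case (less r)
  show ?case
  proof (cases "r = {}")
    case False
    then have "Field r \<noteq> {}" by (auto simp: Field_def)
    then show ?thesis
      using less assms(3) False
      by (metis underS_Restr_ordLess Well_order_Restr)
  qed (use assms in simp)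
qed

text \<open>The quantifiers in \<open>hard\<close> become the countable unions of the class. D is
  generalised because the induction passes to sections of D. Only the positive conditions
  \<open>D z p\<close> are open, as for differences of branches at some position with a given
  label.\<close>

lemma Sigma0_cls_hard:
  assumes "Well_order r"
    and "\<And>p. openin X {z \<in> topspace X. D z p}"
  shows "Sigma0_cls X r {z \<in> topspace X. hard r (D z)}"
  using assms
proof (induction r arbitrary: D rule: Well_order_underS_induct)
  case empty
  have "{z \<in> topspace X. hard {} (D z)} = (\<Union>p. {z \<in> topspace X. D z p})"
    by auto
  then show ?case
    using empty by (auto intro!: Sigma0_cls_open)
next
  case (step r)
  obtain a0 where a0: "a0 \<in> Field r"
    using \<open>r \<noteq> {}\<close> by (auto simp: Field_def)
  \<comment> \<open>The sets B n must run over all pairs (a, i) with a in \<open>Field r\<close>;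
    numbers whose first component lies outside the field are redirected to \<open>a0\<close>, which
    adds no new set to the union.\<close>
  define c where "c n = (if fst (prod_decode n) \<in> Field r then fst (prod_decode n) else a0)" for n
  define B where "B n = {z \<in> topspace X. \<not> hard (Restr r (underS r (c n))) (sec (c n) (snd (prod_decode n)) (D z))}" for n
  have c: "c n \<in> Field r" for n
    using a0 by (simp add: c_def)
  have "Sigma0_cls X r (\<Union>n. B n)"
  proof (rule Sigma0_cls_union)
    fix n
    have "topspace X - B n = {z \<in> topspace X. hard (Restr r (underS r (c n))) (sec (c n) (snd (prod_decode n)) (D z))}"
      by (auto simp: B_def)
    moreover have "Sigma0_cls X (Restr r (underS r (c n))) \<dots>"
      by (rule step.IH[OF c]) (auto simp: sec_def step.prems split: prod.splits)
    ultimately show "B n \<subseteq> topspace X \<and> (\<exists>a\<in>Field r. Sigma0_cls X (Restr r (underS r a)) (topspace X - B n))"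
      using c by (auto simp: B_def)
  qed (use step in auto)
  moreover have "(\<Union>n. B n) = {z \<in> topspace X. hard r (D z)}"
  proof -
    have "\<exists>n. c n = a \<and> snd (prod_decode n) = i" if "a \<in> Field r" for a i
      using that by (intro exI[of _ "prod_encode (a, i)"]) (simp add: c_def)
    then have "(\<exists>n. z \<in> B n) \<longleftrightarrow> z \<in> topspace X \<and> hard r (D z)" for z
      unfolding B_def hard_nonempty[OF step.hyps] mem_Collect_eq using c by metis
    then show ?thesis by blast
  qed
  ultimately show ?case by simp
qed

text \<open>The whole space and the empty set have codes at every level. Each is built from the
  other one level down, since \<open>hard\<close> negates its subcodes; hence the two claims are
  proved together.\<close>

lemma hard_trace_const:
  assumes "Well_order r"
  shows "(\<exists>e. \<forall>x. hard r (trace e x)) \<and> (\<exists>e. \<forall>x. \<not> hard r (trace e x))"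
  using assms
proof (induction r rule: Well_order_underS_induct)
  case empty
  have "\<forall>x. hard {} (trace (\<lambda>_. True) x)" "\<forall>x. \<not> hard {} (trace (\<lambda>_. False) x)"
    by (auto simp: trace_def cyl_def intro: exI[of _ "[]"])
  then show ?case by blast
next
  case (step r)
  obtain E N where E: "\<And>a x. a \<in> Field r \<Longrightarrow> hard (Restr r (underS r a)) (trace (E a) x)"
    and N: "\<And>a x. a \<in> Field r \<Longrightarrow> \<not> hard (Restr r (underS r a)) (trace (N a) x)"
    using step.IH by metis
  have "\<forall>x. hard r (trace (join (\<lambda>a i. N a)) x)" "\<forall>x. \<not> hard r (trace (join (\<lambda>a i. E a)) x)"
    using step.hyps E N by (auto simp: hard_nonempty Field_def)
  then show ?case by blast
qed

text \<open>Universality of \<open>hard\<close>: codes for the sets in a union are joined into a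
  code for the union, so every set of the class has a code. This drives the diagonal
  argument.\<close>

lemma Sigma0_cls_trace:
  assumes "Sigma0_cls cantor_space r S" and "Well_order r"
  shows "\<exists>e. \<forall>x. x \<in> S \<longleftrightarrow> hard r (trace e x)"
  using assms
proof (induction "cantor_space" r S)
  case (Sigma0_cls_open U)
  \<comment> \<open>An open set is coded by marking all cylinders contained in it.\<close>
  have "x \<in> U \<longleftrightarrow> hard {} (trace (\<lambda>(js, s). cyl s \<subseteq> U) x)" for x
  proof
    assume "x \<in> U"
    then obtain n where "cyl (map x [0..<n]) \<subseteq> U"
      using Sigma0_cls_open openin_cantor by metis
    moreover have "x \<in> cyl (map x [0..<n])" by (simp add: cyl_map)
    ultimately show "hard {} (trace (\<lambda>(js, s). cyl s \<subseteq> U) x)"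
      unfolding hard_empty trace_def by (intro exI[of _ "([], map x [0..<n])"]) simp
  qed (auto simp: trace_def)
  then show ?case by blast
next
  case (Sigma0_cls_union r B)
  have "\<exists>a e. a \<in> Field r \<and> (\<forall>x. x \<notin> B n \<longleftrightarrow> hard (Restr r (underS r a)) (trace e x))" for n
    using Sigma0_cls_union Well_order_Restr by fastforce
  then obtain c e where c: "\<And>n. c n \<in> Field r"
    and e: "\<And>n x. x \<notin> B n \<longleftrightarrow> hard (Restr r (underS r (c n))) (trace (e n) x)"
    by metis
  have "\<exists>e. \<forall>x. hard (Restr r (underS r a)) (trace e x)" for a
    using hard_trace_const[OF Well_order_Restr[OF Sigma0_cls_union.prems]] by blast
  then obtain E where E: "\<And>a x. hard (Restr r (underS r a)) (trace (E a) x)"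
    by metis
  \<comment> \<open>The slot (c i, i) holds the code of the complement of B i, so its negation
    contributes B i. All other slots hold codes of the whole space, whose negation contributes
    nothing.\<close>
  let ?J = "join (\<lambda>a i. if a = c i then e i else E a)"
  have "x \<in> (\<Union>n. B n) \<longleftrightarrow> hard r (trace ?J x)" for x
  proof -
    have "\<not> hard (Restr r (underS r a)) (trace (if a = c i then e i else E a) x) \<longleftrightarrow> a = c i \<and> x \<in> B i" for a i
      using E e by auto
    then show ?thesis
      unfolding hard_nonempty[OF Sigma0_cls_union.prems Sigma0_cls_union.hyps(1)] sec_trace sec_join
      using c by auto
  qed
  then show ?case by blast
qed

lemma continuous_map_cantorI:
  assumes "\<And>k. openin X {x \<in> topspace X. f x k}" "\<And>k. openin X {x \<in> topspace X. \<not> f x k}"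
  shows "continuous_map X cantor_space f"
  unfolding cantor_space_def continuous_map_componentwise_UNIV
proof
  fix k
  show "continuous_map X (discrete_topology UNIV) (\<lambda>x. f x k)"
    unfolding continuous_map_def
  proof (intro conjI allI impI)
    fix U :: "bool set"
    show "openin X {x \<in> topspace X. f x k \<in> U}"
    proof -
      have "{x \<in> topspace X. f x k \<in> U} =
        (if True \<in> U then {x \<in> topspace X. f x k} else {}) \<union> (if False \<in> U then {x \<in> topspace X. \<not> f x k} else {})"
        by (auto, (metis (full_types))+)
      then show ?thesis using assms by auto
    qed
  qed auto
qed

lemma openin_cantor_coord:
  "openin cantor_space {x. x k}" "openin cantor_space {x. \<not> x k}"
proof -
  have "cyl (map x [0..<Suc k]) \<subseteq> {y. y k = x k}" for x
    unfolding cyl_map by auto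
  then show "openin cantor_space {x. x k}" "openin cantor_space {x. \<not> x k}"
    unfolding openin_cantor by (metis (mono_tags, lifting) mem_Collect_eq subset_iff)+
qed

text \<open>Diagonalisation: otherwise the set of all x lying outside the set coded by x itself
  would have a code e, and a point x with \<open>decode x = e\<close> gives a contradiction.\<close>

lemma not_Pi0_cls_hard:
  assumes r: "Well_order r"
  shows "\<not> Pi0_cls cantor_space r {x. hard r (decode x)}"
proof
  assume *: "Pi0_cls cantor_space r {x. hard r (decode x)}"
  \<comment> \<open>The trace is written back as a point of Cantor space. The map is continuous
    because a coordinate of \<open>g x\<close> depends on one coordinate of x and on membership of x
    in one cylinder.\<close>
  define g where "g x k = trace (decode x) x (from_nat k)" for x k
  have g: "decode (g x) = trace (decode x) x" for x
    by (simp add: g_def decode_def fun_eq_iff)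
  have "continuous_map cantor_space cantor_space g"
  proof (rule continuous_map_cantorI)
    fix k
    obtain js s where p: "from_nat k = (js :: (nat \<times> nat) list, s :: bool list)" by fastforce
    have 1: "{x. g x k} = {x. x (to_nat (js, s))} \<inter> cyl s"
      by (auto simp: g_def p trace_def decode_def)
    then show "openin cantor_space {x \<in> topspace cantor_space. g x k}"
      by (simp add: openin_cantor_coord openin_cyl openin_Int)
    have 2: "openin cantor_space (- cyl s)"
      unfolding openin_cantor by (auto simp: cyl_map cyl_def intro!: exI[of _ "length s"])
    have "{x. \<not> g x k} = {x. \<not> x (to_nat (js, s))} \<union> (- cyl s)"
      using 1 by auto
    then show "openin cantor_space {x \<in> topspace cantor_space. \<not> g x k}"
      by (simp add: openin_cantor_coord 2 openin_Un)
  qed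
  from Pi0_cls_preimage[OF * this]
  have "Sigma0_cls cantor_space r {x. \<not> hard r (trace (decode x) x)}"
    by (simp add: Pi0_cls_def g Collect_neg_eq Compl_eq_Diff_UNIV)
  from Sigma0_cls_trace[OF this r] obtain e
    where "\<And>x. \<not> hard r (trace (decode x) x) \<longleftrightarrow> hard r (trace e x)" by auto
  with surj_decode[of e] show False by metis
qed

subsection \<open>Acyclicity\<close>

text \<open>A substitute for cycles that is easier to induct on. Exempting one vertex u lets the
  property survive cutting a bridge, where one end loses a neighbour.\<close>

definition leafless :: "('v \<Rightarrow> 'v \<Rightarrow> bool) \<Rightarrow> 'v \<Rightarrow> 'v set \<Rightarrow> bool" where
  "leafless E u W \<longleftrightarrow> (\<forall>w\<in>W - {u}. \<exists>x\<in>W. \<exists>y\<in>W. x \<noteq> y \<and> E w x \<and> E w y)"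

text \<open>On a cycle every vertex has two distinct neighbours, so its vertex set is leafless for
  every u and would have at most one element.\<close>

lemma acyclic_graph_leaflessI:
  assumes sym: "\<And>x y. E x y \<Longrightarrow> E y x"
    and E: "\<And>u W. leafless E u W \<Longrightarrow> W \<subseteq> {u}"
  shows "acyclic_graph E"
  unfolding acyclic_graph_def
proof
  assume "\<exists>vs. 3 \<le> length vs \<and> distinct vs \<and> (\<forall>i<length vs. E (vs ! i) (vs ! ((i + 1) mod length vs)))"
  then obtain vs where vs: "3 \<le> length vs" "distinct vs"
    and edge: "\<And>i. i < length vs \<Longrightarrow> E (vs ! i) (vs ! ((i + 1) mod length vs))" by blast
  let ?n = "length vs"
  have "\<exists>x\<in>set vs. \<exists>y\<in>set vs. x \<noteq> y \<and> E w x \<and> E w y" if w: "w \<in> set vs" for w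
  proof -
    obtain i where i: "i < ?n" "w = vs ! i"
      using w unfolding in_set_conv_nth by blast
    \<comment> \<open>The cyclic successor and predecessor of i; they are different because the
      cycle has at least three vertices.\<close>
    let ?j = "(i + 1) mod ?n" let ?k = "if i = 0 then ?n - 1 else i - 1"
    have j: "?j = (if i + 1 = ?n then 0 else i + 1)"
      using i(1) by (cases "i + 1 = ?n") auto
    have k: "?k < ?n" "?k + 1 = (if i = 0 then ?n else i)"
      using i(1) by (cases "i = 0"; simp)+
    then have k_mod: "(?k + 1) mod ?n = i"
      using i(1) by simp
    have "?j \<noteq> ?k"
      using i(1) vs(1) unfolding j by (cases "i = 0"; cases "i + 1 = ?n"; simp)
    have "?j < ?n"
      by (rule mod_less_divisor) (use i(1) in linarith)
    have "vs ! ?j \<noteq> vs ! ?k"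
      using nth_eq_iff_index_eq[OF vs(2) \<open>?j < ?n\<close> k(1)] \<open>?j \<noteq> ?k\<close> by blast
    moreover have "E w (vs ! ?j)" "E w (vs ! ?k)"
      using edge[OF i(1)] sym[OF edge[OF k(1)]] by (simp_all only: k_mod i(2))
    ultimately show ?thesis
      using nth_mem[OF \<open>?j < ?n\<close>] nth_mem[OF k(1)] by blast
  qed
  then have "leafless E u (set vs)" for u
    by (auto simp: leafless_def)
  then have "set vs \<subseteq> {vs ! 0}"
    by (intro E)
  then have "card (set vs) \<le> 1"
    using card_mono[of "{vs ! 0}" "set vs"] by simp
  then show False
    using vs(1) distinct_card[OF vs(2)] by simp
qed

text \<open>With u on one side of the bridge, the part of W on the other side is leafless with the
  far end of the bridge as exceptional vertex, hence contains at most that end. Two neighbours of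
  that end cannot be found, so W stays on the side of u.\<close>

lemma leafless_bridge:
  assumes sym: "\<And>x y. E x y \<Longrightarrow> E y x" and irrefl: "\<And>x. \<not> E x x"
    and A: "\<And>u W. W \<subseteq> A \<Longrightarrow> leafless E u W \<Longrightarrow> W \<subseteq> {u}"
    and B: "\<And>u W. W \<subseteq> - A \<Longrightarrow> leafless E u W \<Longrightarrow> W \<subseteq> {u}"
    and cross: "\<And>x y. x \<in> A \<Longrightarrow> y \<notin> A \<Longrightarrow> E x y \<Longrightarrow> x = a \<and> y = b"
    and W: "leafless E u W"
  shows "W \<subseteq> {u}"
proof -
  \<comment> \<open>The case of u in A, with A, a, b generalised so that it applies to the
    complement of A with a and b exchanged.\<close>
  have main: "W \<subseteq> {u}"
    if sym: "\<And>x y. E x y \<Longrightarrow> E y x"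
    and A: "\<And>u W. W \<subseteq> A \<Longrightarrow> leafless E u W \<Longrightarrow> W \<subseteq> {u}"
    and B: "\<And>u W. W \<subseteq> - A \<Longrightarrow> leafless E u W \<Longrightarrow> W \<subseteq> {u}"
    and cross: "\<And>x y. x \<in> A \<Longrightarrow> y \<notin> A \<Longrightarrow> E x y \<Longrightarrow> x = a \<and> y = b"
    and u: "u \<in> A" for A a b
  proof -
    have "leafless E b (W - A)"
      unfolding leafless_def
    proof
      fix w assume w: "w \<in> W - A - {b}"
      then obtain x y where xy: "x \<in> W" "y \<in> W" "x \<noteq> y" "E w x" "E w y"
        using W u unfolding leafless_def by blast
      then have "x \<notin> A" "y \<notin> A"
        using cross sym w by blast+
      then show "\<exists>x\<in>W - A. \<exists>y\<in>W - A. x \<noteq> y \<and> E w x \<and> E w y"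
        using xy by blast
    qed
    then have WA: "W - A \<subseteq> {b}"
      using B by blast
    have "b \<notin> W - A"
    proof
      \<comment> \<open>Since u is in A, b has two distinct neighbours in W. Across the bridge there
        is only a, and on its own side only b itself, which irreflexivity excludes.\<close>
      assume b: "b \<in> W - A"
      then obtain x y where xy: "x \<in> W" "y \<in> W" "x \<noteq> y" "E b x" "E b y"
        using W u unfolding leafless_def by blast
      then show False
        using WA irrefl cross sym b by (metis Diff_iff subsetD singletonD)
    qed
    then have "W \<subseteq> A" using WA by blast
    then show ?thesis using A W by blast
  qed
  show ?thesis
  proof (cases "u \<in> A")
    case True
    then show ?thesis using main[of A a b] sym A B cross by blast
  next
    case False
    then show ?thesis
    proof (intro main[of "- A" b a])
      show "x = b \<and> y = a" if "x \<in> - A" "y \<notin> - A" "E x y" for x y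
        using cross[of y x] sym that by auto
    qed (use sym A B in auto)
  qed
qed

lemma leafless_image:
  assumes "inj_on f W" and "leafless E u W"
    and "\<And>x y. x \<in> W \<Longrightarrow> y \<in> W \<Longrightarrow> E x y \<Longrightarrow> E' (f x) (f y)"
  shows "leafless E' (f u) (f ` W)"
  unfolding leafless_def
proof
  fix z assume "z \<in> f ` W - {f u}"
  then obtain w where w: "w \<in> W" "w \<noteq> u" "z = f w" by auto
  then obtain x y where xy: "x \<in> W" "y \<in> W" "x \<noteq> y" "E w x" "E w y"
    using assms(2) unfolding leafless_def by blast
  then have "f x \<noteq> f y" using assms(1) by (auto dest: inj_onD)
  then show "\<exists>x\<in>f ` W. \<exists>y\<in>f ` W. x \<noteq> y \<and> E' z x \<and> E' z y"
    using xy w assms(3) by blast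
qed

section \<open>The sparse tree and its level graphs\<close>

definition sparse_tree :: "(nat \<Rightarrow> bool list) \<Rightarrow> (nat \<Rightarrow> bool list) \<Rightarrow> (bool list \<times> bool list) set" where
  "sparse_tree sL tL = {(s, t). length s = length t \<and>
     (\<forall>l<length s. s ! l \<noteq> t ! l \<longrightarrow> \<not> s ! l \<and> take l s = sL l \<and> take l t = tL l)}"

lemma is_tree22_sparse_tree: "is_tree22 (sparse_tree sL tL)"
  unfolding is_tree22_def
proof (intro conjI allI impI)
  show "\<forall>(s, t)\<in>sparse_tree sL tL. length s = length t"
    by (auto simp: sparse_tree_def)
  fix s t :: "bool list" and p
  assume st: "(s, t) \<in> sparse_tree sL tL \<and> p \<le> length s"
  have "\<not> s ! l \<and> take l s = sL l \<and> take l t = tL l" if "l < p" "s ! l \<noteq> t ! l" for l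
  proof -
    have "l < length s" using st that(1) by linarith
    then show ?thesis
      using st that(2) unfolding sparse_tree_def mem_Collect_eq prod.case by blast
  qed
  then show "(take p s, take p t) \<in> sparse_tree sL tL"
    using st by (auto simp: sparse_tree_def min_absorb1)
qed

lemma sparse_tree_snoc:
  "(s @ [b], t @ [d]) \<in> sparse_tree sL tL \<longleftrightarrow> (s, t) \<in> sparse_tree sL tL \<and>
     (b \<noteq> d \<longrightarrow> \<not> b \<and> s = sL (length s) \<and> t = tL (length s))"
proof (cases "length s = length t")
  case True
  then show ?thesis
    by (simp add: sparse_tree_def nth_append less_Suc_eq all_conj_distrib imp_disjL cong: conj_cong)
       (safe; simp)
qed (simp add: sparse_tree_def)

text \<open>Induction on the level: vertices of level \<open>Suc p\<close> are split by their last
  bit. Deleting that bit embeds each half into level p, and the only edge between the halves is the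
  one over the prescribed pair, so \<open>leafless_bridge\<close> applies.\<close>

lemma leafless_sparse_tree:
  "leafless (level_graph_edge (sparse_tree sL tL) p) u W \<Longrightarrow> W \<subseteq> {u}"
proof (induction p arbitrary: u W)
  case 0
  \<comment> \<open>Level 0 is a single edge, so no vertex has two neighbours.\<close>
  have E: "level_graph_edge (sparse_tree sL tL) 0 w x \<longleftrightarrow> fst w = [] \<and> x = ([], \<not> snd w)" for w x
    by (cases w; cases x; auto simp: level_graph_edge_def sparse_tree_def)
  show ?case
    using 0 unfolding leafless_def E by blast
next
  case (Suc p)
  let ?E = "\<lambda>p. level_graph_edge (sparse_tree sL tL) p"
  define f where "f w = (butlast (fst w), snd w)" for w :: "bool list \<times> bool"
  define V where "V b = {w :: bool list \<times> bool. fst w \<noteq> [] \<and> last (fst w) = b}" for b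
  have edge: "\<exists>s t b d. (w = (s @ [b], False) \<and> x = (t @ [d], True) \<or> x = (s @ [b], False) \<and> w = (t @ [d], True)) \<and>
      length s = p \<and> length t = p \<and> (s, t) \<in> sparse_tree sL tL \<and> 
      (b \<noteq> d \<longrightarrow> \<not> b \<and> s = sL p \<and> t = tL p)" if E: "?E (Suc p) w x" for w x
  proof -
    obtain s t where st: "(s, t) \<in> sparse_tree sL tL" "length s = Suc p" "length t = Suc p"
      "w = (s, False) \<and> x = (t, True) \<or> x = (s, False) \<and> w = (t, True)"
      using E unfolding level_graph_edge_def by metis
    obtain s' b where s: "s = s' @ [b]" using st(2) by (metis length_Suc_conv_rev)
    obtain t' d where t: "t = t' @ [d]" using st(3) by (metis length_Suc_conv_rev)
    show ?thesis
      by (rule exI[of _ s'], rule exI[of _ t'], rule exI[of _ b], rule exI[of _ d])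
        (use st in \<open>auto simp: s t sparse_tree_snoc\<close>)
  qed
  have part: "W \<subseteq> {u}" if V: "W \<subseteq> V b" and W: "leafless (?E (Suc p)) u W" for u W b
  proof -
    have inj: "inj_on f (V b)"
    proof (rule inj_onI)
      fix x y assume "x \<in> V b" "y \<in> V b" "f x = f y"
      then show "x = y"
        using append_butlast_last_id[of "fst x"] append_butlast_last_id[of "fst y"]
        by (auto simp: f_def V_def prod_eq_iff)
    qed
    have "leafless (?E p) (f u) (f ` W)"
    proof (rule leafless_image[OF inj_on_subset[OF inj V] W])
      fix x y assume "x \<in> W" "y \<in> W" "?E (Suc p) x y"
      then show "?E p (f x) (f y)"
        using edge[of x y] by (auto simp: f_def level_graph_edge_def)
    qed
    then have fW: "f ` W \<subseteq> {f u}" by (rule Suc.IH)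
    show ?thesis
    proof
      fix w assume w: "w \<in> W"
      show "w \<in> {u}"
      \<comment> \<open>A vertex of W other than u has two distinct neighbours in W; both have the
        image \<open>f u\<close>, against injectivity of f on \<open>V b\<close>.\<close>
      proof (rule ccontr)
        assume "w \<notin> {u}"
        then obtain x y where "x \<in> W" "y \<in> W" "x \<noteq> y"
          using W w unfolding leafless_def by blast
        moreover have "f x = f u" "f y = f u" using fW \<open>x \<in> W\<close> \<open>y \<in> W\<close> by blast+
        ultimately show False using inj_onD[OF inj, of x y] V by auto
      qed
    qed
  qed
  have nonempty: "?E (Suc p) w x \<Longrightarrow> w \<in> V False \<union> V True \<and> x \<in> V False \<union> V True" for w x
    using edge[of w x] by (auto simp: V_def)
  show ?case
  proof (rule leafless_bridge[where E = "?E (Suc p)" and A = "V False" and a = "(sL p @ [False], False)" and b = "(tL p @ [True], True)"])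
    show "?E (Suc p) x y \<Longrightarrow> ?E (Suc p) y x" for x y
      by (auto simp: level_graph_edge_def)
    show "\<not> ?E (Suc p) x x" for x
      by (auto simp: level_graph_edge_def)
    show "W \<subseteq> {u}" if "W \<subseteq> V False" "leafless (?E (Suc p)) u W" for u W
      using part that by blast
    show "W \<subseteq> {u}" if V: "W \<subseteq> - V False" and W: "leafless (?E (Suc p)) u W" for u W
    proof -
      \<comment> \<open>The complement of \<open>V False\<close> also contains vertices with an
        empty list. These lie on no edge of this level, so elements of W other than u, together with
        their neighbours in W, belong to \<open>V True\<close>.\<close>
      have *: "\<exists>x y. w \<in> V True \<and> x \<in> W \<inter> V True \<and> y \<in> W \<inter> V True \<and> x \<noteq> y \<and> ?E (Suc p) w x \<and> ?E (Suc p) w y" if w: "w \<in> W" "w \<noteq> u" for w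
      proof -
        obtain x y where xy: "x \<in> W" "y \<in> W" "x \<noteq> y" "?E (Suc p) w x" "?E (Suc p) w y"
          using w W unfolding leafless_def by blast
        show ?thesis
          using nonempty[OF xy(4)] nonempty[OF xy(5)] xy V w by blast
      qed
      have "leafless (?E (Suc p)) u (W \<inter> V True)"
        unfolding leafless_def
      proof
        fix w assume "w \<in> W \<inter> V True - {u}"
        then show "\<exists>x\<in>W \<inter> V True. \<exists>y\<in>W \<inter> V True. x \<noteq> y \<and> ?E (Suc p) w x \<and> ?E (Suc p) w y"
          using *[of w] by blast
      qed
      then have "W \<inter> V True \<subseteq> {u}" using part by blast
      then show ?thesis using * by blast
    qed
    \<comment> \<open>Different last bits must be 0 on the left and 1 on the right, over the
      prescribed pair; this is the bridge.\<close>
    show "x = (sL p @ [False], False) \<and> y = (tL p @ [True], True)"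
      if "x \<in> V False" "y \<notin> V False" "?E (Suc p) x y" for x y
      using edge[OF that(3)] that by (auto simp: V_def)
    show "leafless (?E (Suc p)) u W" by fact
  qed
qed

lemma acyclic_levels_sparse_tree: "acyclic_levels (sparse_tree sL tL)"
  unfolding acyclic_levels_def
proof
  fix p
  show "acyclic_graph (level_graph_edge (sparse_tree sL tL) p)"
    by (rule acyclic_graph_leaflessI[OF _ leafless_sparse_tree]) (auto simp: level_graph_edge_def)
qed

subsection \<open>Category and limits of chains\<close>

text \<open>The union of a chain of finite sequences. Stage \<open>Suc i\<close> is the first at
  which the bound \<open>n \<le> length (S n)\<close> guarantees an entry with index i.\<close>

definition limit_path :: "(nat \<Rightarrow> bool list) \<Rightarrow> nat \<Rightarrow> bool" where
  "limit_path S i = S (Suc i) ! i"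

lemma chain_append:
  assumes "\<And>n. \<exists>v. S (Suc n) = S n @ v" and "m \<le> n"
  shows "\<exists>v. S n = S m @ v"
  using assms(2)
proof (induction n rule: dec_induct)
  case (step n)
  then show ?case using assms(1)[of n] by (metis append.assoc)
qed simp

lemma limit_path_in_cyl:
  assumes ext: "\<And>n. \<exists>v. S (Suc n) = S n @ v" and len: "\<And>n. n \<le> length (S n)"
  shows "limit_path S \<in> cyl (S n)"
  unfolding cyl_def
proof (intro CollectI allI impI)
  fix i assume i: "i < length (S n)"
  have i': "i < length (S (Suc i))" using len[of "Suc i"] by simp
  show "limit_path S i = S n ! i"
  proof (cases "Suc i \<le> n")
    case True
    then obtain v where "S n = S (Suc i) @ v" using chain_append[of S, OF ext] by blast
    then show ?thesis using i' by (simp add: limit_path_def nth_append)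
  next
    case False
    then obtain v where "S (Suc i) = S n @ v" using chain_append[of S n "Suc i", OF ext] by auto
    then show ?thesis using i by (simp add: limit_path_def nth_append)
  qed
qed

lemma cyl_nth: "x \<in> cyl s \<Longrightarrow> i < length s \<Longrightarrow> x i = s ! i"
  by (simp add: cyl_def)

lemma cyl_append_subset: "cyl (s @ t) \<subseteq> cyl s"
proof
  fix x assume x: "x \<in> cyl (s @ t)"
  have "x i = s ! i" if "i < length s" for i
    using cyl_nth[OF x, of i] that by (simp add: nth_append)
  then show "x \<in> cyl s" by (simp add: cyl_def)
qed

lemma cyl_comparable:
  assumes x: "x \<in> cyl s" "x \<in> cyl t" and le: "length s \<le> length t"
  shows "\<exists>v. t = s @ v"
proof -
  have "take (length s) t = s"
  proof (rule nth_equalityI)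
    fix i assume "i < length (take (length s) t)"
    then have i: "i < length s" "i < length t" using le by auto
    show "take (length s) t ! i = s ! i"
      using cyl_nth[OF x(1) i(1)] cyl_nth[OF x(2) i(2)] i(1) by simp
  qed (use le in simp)
  then have "t = s @ drop (length s) t" using append_take_drop_id[of "length s" t] by simp
  then show ?thesis by blast
qed

section \<open>Baire category for the usual topology of Cantor space\<close>

definition nowhere_dense :: "(nat \<Rightarrow> bool) set \<Rightarrow> bool" where
  "nowhere_dense A \<longleftrightarrow> (\<forall>s. \<exists>w. cyl (s @ w) \<inter> A = {})"

definition meager :: "(nat \<Rightarrow> bool) set \<Rightarrow> bool" where
  "meager A \<longleftrightarrow> (\<exists>F :: nat \<Rightarrow> _. (\<forall>n. nowhere_dense (F n)) \<and> A \<subseteq> (\<Union>n. F n))"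

lemma meager_subset:
  assumes "meager B" "A \<subseteq> B"
  shows "meager A"
proof -
  obtain F :: "nat \<Rightarrow> _" where "\<And>n. nowhere_dense (F n)" "B \<subseteq> (\<Union>n. F n)"
    using assms(1) unfolding meager_def by blast
  then show ?thesis
    unfolding meager_def using assms(2) by (intro exI[of _ F]) simp
qed

lemma meager_empty: "meager {}"
  unfolding meager_def nowhere_dense_def by (intro exI[of _ "\<lambda>_. {}"]) simp

lemma nowhere_dense_imp_meager: "nowhere_dense A \<Longrightarrow> meager A"
  unfolding meager_def by (intro exI[of _ "\<lambda>_. A"]) simp

lemma meager_UN:
  fixes A :: "nat \<Rightarrow> (nat \<Rightarrow> bool) set"
  assumes "\<And>n. meager (A n)"
  shows "meager (\<Union>n. A n)"
proof -
  have "\<forall>n. \<exists>F :: nat \<Rightarrow> _. (\<forall>m. nowhere_dense (F m)) \<and> A n \<subseteq> (\<Union>m. F m)"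
    using assms unfolding meager_def by simp
  from choice[OF this] obtain F :: "nat \<Rightarrow> nat \<Rightarrow> _"
    where F: "\<And>n m. nowhere_dense (F n m)" "\<And>n. A n \<subseteq> (\<Union>m. F n m)" by blast
  have "(\<Union>n. A n) \<subseteq> (\<Union>k. F (fst (prod_decode k)) (snd (prod_decode k)))"
  proof
    fix x assume "x \<in> (\<Union>n. A n)"
    then obtain n m where "x \<in> F n m" using F(2) by blast
    then show "x \<in> (\<Union>k. F (fst (prod_decode k)) (snd (prod_decode k)))"
      by (intro UN_I[of "prod_encode (n, m)"]) simp_all
  qed
  then show ?thesis
    unfolding meager_def using F(1)
    by (intro exI[of _ "\<lambda>k. F (fst (prod_decode k)) (snd (prod_decode k))"]) simp
qed

lemma meager_UN_countable:
  fixes A :: "'i::countable \<Rightarrow> (nat \<Rightarrow> bool) set"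
  assumes "\<And>i. meager (A i)"
  shows "meager (\<Union>i. A i)"
proof (rule meager_subset[OF meager_UN[of "\<lambda>n. A (from_nat n)"]])
  show "meager (A (from_nat n))" for n by (rule assms)
  show "(\<Union>i. A i) \<subseteq> (\<Union>n. A (from_nat n))"
  proof
    fix x assume "x \<in> (\<Union>i. A i)"
    then obtain i where "x \<in> A i" by blast
    then have "x \<in> A (from_nat (to_nat i))" by simp
    then show "x \<in> (\<Union>n. A (from_nat n))" by blast
  qed
qed

lemma meager_Un:
  assumes "meager A" "meager B"
  shows "meager (A \<union> B)"
proof -
  have "meager (\<Union>b. if b then A else B)"
    using assms by (intro meager_UN_countable) simp
  then show ?thesis by (simp add: UNIV_bool Un_commute)
qed

lemma cyl_not_meager: "\<not> meager (cyl s)"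
proof
  assume "meager (cyl s)"
  then obtain F :: "nat \<Rightarrow> _" where F: "\<And>n. nowhere_dense (F n)" "cyl s \<subseteq> (\<Union>n. F n)"
    unfolding meager_def by blast
  have "\<forall>n t. \<exists>w. cyl (t @ w) \<inter> F n = {}"
    using F(1) unfolding nowhere_dense_def by blast
  then obtain W where W: "\<And>n t. cyl (t @ W n t) \<inter> F n = {}"
    by metis
  \<comment> \<open>Stage n + 1 enters a subcylinder missing F n. The additional bit makes the
    lengths grow even if \<open>W n t\<close> is empty, so that the chain has a limit.\<close>
  define S where "S = rec_nat s (\<lambda>n t. t @ W n t @ [False])"
  have S: "S 0 = s" "S (Suc n) = S n @ W n (S n) @ [False]" for n
    by (simp_all add: S_def)
  have "n \<le> length (S n)" for n
    by (induction n) (simp_all add: S)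
  then have mem: "limit_path S \<in> cyl (S n)" for n
    using S(2) by (intro limit_path_in_cyl) auto
  then have "limit_path S \<in> cyl (S n @ W n (S n))" for n
    using cyl_append_subset[of "S n @ W n (S n)" "[False]"] mem[of "Suc n"] by (auto simp: S(2))
  then have "limit_path S \<notin> F n" for n
    using W by blast
  then show False
    using F(2) mem[of 0] S(1) by auto
qed

text \<open>Nonmeager everywhere in \<open>cyl s\<close>. This passes to extensions of s, so the
  fusion may lengthen a sequence freely before it shrinks the set.\<close>

definition big :: "bool list \<Rightarrow> (nat \<Rightarrow> bool) set \<Rightarrow> bool" where
  "big s U \<longleftrightarrow> (\<forall>w. \<not> meager (U \<inter> cyl (s @ w)))"

lemma big_UNIV: "big s UNIV"
  by (simp add: big_def cyl_not_meager)

lemma big_append: "big s U \<Longrightarrow> big (s @ w) U"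
  by (simp add: big_def)

lemma big_not_meager:
  assumes "big s U"
  shows "\<not> meager (U \<inter> cyl s)"
  using assms[unfolded big_def, rule_format, of "[]"] by simp

lemma big_nonempty: "big s U \<Longrightarrow> U \<inter> cyl s \<noteq> {}"
  using big_not_meager[of s U] meager_empty by metis

text \<open>Otherwise every subcylinder of \<open>cyl s\<close> contains one in which U is meager. U
  is then meager in the union M of such cylinders, as there are countably many bit lists, and the
  rest of \<open>cyl s\<close> is nowhere dense; so U would be meager in
  \<open>cyl s\<close>.\<close>

lemma nonmeager_imp_big:
  assumes "\<not> meager (U \<inter> cyl s)"
  shows "\<exists>w. big (s @ w) U"
proof (rule ccontr)
  assume "\<nexists>w. big (s @ w) U"
  then have small: "\<exists>v. meager (U \<inter> cyl (s @ w @ v))" for w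
    by (auto simp: big_def)
  define M where "M = (\<Union>v. if meager (U \<inter> cyl (s @ v)) then cyl (s @ v) else {})"
  have "meager (\<Union>v. if meager (U \<inter> cyl (s @ v)) then U \<inter> cyl (s @ v) else {})"
    by (rule meager_UN_countable) (simp add: meager_empty)
  then have "meager (U \<inter> M)"
    by (rule meager_subset) (auto simp: M_def split: if_splits)
  moreover have "nowhere_dense (cyl s - M)"
    unfolding nowhere_dense_def
  proof
    fix t
    show "\<exists>w. cyl (t @ w) \<inter> (cyl s - M) = {}"
    proof (cases "cyl t \<inter> cyl s = {}")
      case True
      then show ?thesis by (intro exI[of _ "[]"]) auto
    next
      case False
      then obtain x where x: "x \<in> cyl t" "x \<in> cyl s" by blast
      have "\<exists>u w. t @ u = s @ w"
        using cyl_comparable[of x s t] cyl_comparable[of x t s] x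
        by (metis append_Nil2 linorder_le_cases)
      then obtain u w where uw: "t @ u = s @ w" by blast
      obtain v where v: "meager (U \<inter> cyl (s @ w @ v))" using small by blast
      then have "cyl (s @ w @ v) \<subseteq> M" by (auto simp: M_def)
      moreover have "t @ u @ v = s @ w @ v" using uw by (metis append.assoc)
      ultimately show ?thesis by (intro exI[of _ "u @ v"]) (simp only:, blast)
    qed
  qed
  ultimately have "meager (U \<inter> M \<union> (cyl s - M))"
    by (metis meager_Un nowhere_dense_imp_meager)
  then show False
    using assms meager_subset[of "U \<inter> M \<union> (cyl s - M)" "U \<inter> cyl s"] by blast
qed

text \<open>Some piece of a countable cover is nonmeager in \<open>cyl s\<close>, hence big after an
  extension. Applied to covers by small balls of a finer metric, it yields small sets that are still
  big.\<close>

lemma big_cover: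
  fixes A :: "nat \<Rightarrow> (nat \<Rightarrow> bool) set"
  assumes "big s U" and "(\<Union>i. A i) = UNIV"
  shows "\<exists>i w. big (s @ w) (U \<inter> A i)"
proof -
  have "\<exists>i. \<not> meager (U \<inter> A i \<inter> cyl s)"
  proof (rule ccontr)
    assume "\<not> ?thesis"
    then have "meager (\<Union>i. U \<inter> A i \<inter> cyl s)"
      by (intro meager_UN) blast
    moreover have "(\<Union>i. U \<inter> A i \<inter> cyl s) = U \<inter> cyl s"
      using assms(2) by blast
    ultimately show False
      using big_not_meager[OF assms(1)] by simp
  qed
  then show ?thesis using nonmeager_imp_big by blast
qed

section \<open>Convergence of chains in a finer complete metric\<close>

lemma small_ball_cover:
  assumes "Metric_space UNIV d" "separable_space (Metric_space.mtopology UNIV d)"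
  shows "\<exists>c :: nat \<Rightarrow> 'a. \<forall>e>0. (\<Union>i. Metric_space.mball UNIV d (c i) e) = UNIV"
proof -
  interpret Metric_space UNIV d by fact
  obtain C where C: "countable C" "mtopology closure_of C = UNIV"
    using assms(2) unfolding separable_space_def by auto
  have near: "\<exists>y\<in>C. d y x < e" if "e > 0" for x e
  proof -
    have "x \<in> mtopology closure_of C" using C(2) by simp
    then show ?thesis
      unfolding metric_closure_of using that commute by (auto simp: in_mball)
  qed
  then have "C \<noteq> {}" by (metis empty_iff zero_less_one)
  have "(\<Union>i. mball (from_nat_into C i) e) = UNIV" if e: "e > 0" for e
  proof -
    have "\<exists>i. x \<in> mball (from_nat_into C i) e" for x
    proof -
      obtain y where y: "y \<in> C" "d y x < e" using near[OF e] by blast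
      then obtain i where "from_nat_into C i = y"
        using from_nat_into_surj[OF C(1)] by blast
      then show ?thesis using y by (auto simp: in_mball)
    qed
    then show ?thesis by blast
  qed
  then show ?thesis by blast
qed

text \<open>Points chosen in \<open>U n \<inter> cyl (S n)\<close> form a Cauchy sequence for d, and
  its limit is the limit path. The conclusion is an approximation because the sets
  \<open>U n\<close> are not closed in general.\<close>

lemma limit_path_approximated:
  assumes "Metric_space UNIV d" "Metric_space.mcomplete UNIV d"
    and finer: "finer_topology (Metric_space.mtopology UNIV d) cantor_space"
    and ext: "\<And>n. \<exists>v. S (Suc n) = S n @ v" and len: "\<And>n. n \<le> length (S n)"
    and dec: "\<And>n. U (Suc n) \<subseteq> U n"
    and ne: "\<And>n. U n \<inter> cyl (S n) \<noteq> {}"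
    and small: "\<And>n. \<exists>c. U (Suc n) \<subseteq> Metric_space.mball UNIV d c (inverse (real (Suc n)))"
    and "e > 0"
  shows "\<exists>y\<in>U n. d (limit_path S) y < e"
proof -
  interpret Metric_space UNIV d by fact
  obtain x where x: "\<And>n. x n \<in> U n" "\<And>n. x n \<in> cyl (S n)"
  proof -
    have "\<exists>y. y \<in> U n \<and> y \<in> cyl (S n)" for n using ne[of n] by blast
    then show thesis using that by metis
  qed
  have anti: "U m \<subseteq> U n" if "n \<le> m" for n m
    using lift_Suc_antimono_le[of U, OF dec that] .
  have "MCauchy x"
    unfolding MCauchy_def
  proof (intro conjI allI impI)
    fix e :: real assume "e > 0"
    then obtain k where k: "inverse (real (Suc k)) < e / 2"
      using reals_Archimedean[OF half_gt_zero[OF \<open>e > 0\<close>]] by blast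
    obtain c where c: "U (Suc k) \<subseteq> mball c (inverse (real (Suc k)))" using small[of k] by blast
    have "d (x n) (x m) < e" if "Suc k \<le> n" "Suc k \<le> m" for n m
    proof -
      have "x n \<in> mball c (inverse (real (Suc k)))" "x m \<in> mball c (inverse (real (Suc k)))"
        using x(1)[of n] x(1)[of m] anti[OF that(1)] anti[OF that(2)] c by blast+
      then have "d c (x n) < e / 2" "d c (x m) < e / 2" using k by auto
      moreover have "d (x n) (x m) \<le> d c (x n) + d c (x m)" using triangle[of "x n" c "x m"] commute by simp
      ultimately show ?thesis by simp
    qed
    then show "\<exists>N. \<forall>n n'. N \<le> n \<longrightarrow> N \<le> n' \<longrightarrow> d (x n) (x n') < e" by blast
  qed simp
  then obtain z where z: "limitin mtopology x z sequentially"
    using assms(2) unfolding mcomplete_def by blast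
  \<comment> \<open>Cylinders are open in the finer topology, so convergence for d forces
    convergence of every coordinate, and coordinate i of x n is eventually that of S n.\<close>
  have "z i = limit_path S i" for i
  proof -
    have "openin mtopology (cyl (map z [0..<Suc i]))"
      using finer openin_cyl unfolding finer_topology_def by blast
    moreover have "z \<in> cyl (map z [0..<Suc i])" by (simp only: cyl_map) simp
    ultimately have "\<forall>\<^sub>F n in sequentially. x n \<in> cyl (map z [0..<Suc i])"
      using z unfolding limitin_def by blast
    then obtain N where N: "\<And>n. n \<ge> N \<Longrightarrow> x n \<in> cyl (map z [0..<Suc i])"
      unfolding eventually_sequentially by blast
    define n where "n = max N (Suc i)"
    have i: "i < length (S n)" using len[of n] by (simp add: n_def)
    have "x n i = z i" using N[of n] unfolding cyl_map by (simp add: n_def)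
    moreover have "x n i = S n ! i" using x(2)[of n] i by (simp add: cyl_def)
    moreover have "limit_path S i = S n ! i"
      using limit_path_in_cyl[of S n, OF ext len] i by (simp add: cyl_def)
    ultimately show ?thesis by simp
  qed
  then have "z = limit_path S" by blast
  then have "\<forall>\<^sub>F n in sequentially. d (x n) (limit_path S) < e"
    using z \<open>e > 0\<close> unfolding limitin_metric by auto
  then obtain N where N: "\<And>n. n \<ge> N \<Longrightarrow> d (x n) (limit_path S) < e"
    unfolding eventually_sequentially by blast
  have "x (max N n) \<in> U n" using x(1) anti[of n "max N n"] by auto
  moreover have "d (limit_path S) (x (max N n)) < e" using N commute by (metis max.cobounded1)
  ultimately show ?thesis by blast
qed

text \<open>Sequences g and h that agree on the first n places share the set \<open>U g n\<close>,
  which is small for large n, and both limit paths are approximated from it.\<close>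

lemma continuous_map_limit_path:
  fixes S :: "(nat \<Rightarrow> bool) \<Rightarrow> nat \<Rightarrow> bool list"
  assumes ms: "Metric_space UNIV d" and compl: "Metric_space.mcomplete UNIV d"
    and finer: "finer_topology (Metric_space.mtopology UNIV d) cantor_space"
    and ext: "\<And>g n. \<exists>v. S g (Suc n) = S g n @ v" and len: "\<And>g n. n \<le> length (S g n)"
    and dec: "\<And>g n. U g (Suc n) \<subseteq> U g n"
    and ne: "\<And>g n. U g n \<inter> cyl (S g n) \<noteq> {}"
    and small: "\<And>g n. \<exists>c. U g (Suc n) \<subseteq> Metric_space.mball UNIV d c (inverse (real (Suc n)))"
    and local: "\<And>g h n. \<forall>i<n. g i = h i \<Longrightarrow> U g n = U h n"
  shows "continuous_map cantor_space (Metric_space.mtopology UNIV d) (\<lambda>g. limit_path (S g))"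
proof -
  interpret Metric_space UNIV d by fact
  show ?thesis
    unfolding continuous_map_to_metric
  proof (intro ballI allI impI)
    fix g and e :: real assume "e > 0"
    \<comment> \<open>One quarter for the ball radius and one for the approximation put each limit
      path within e / 2 of c, hence two of them within e of each other.\<close>
    then have e4: "e / 4 > 0" by simp
    then obtain k where k: "inverse (real (Suc k)) < e / 4"
      using reals_Archimedean by blast
    obtain c where c: "U g (Suc k) \<subseteq> mball c (inverse (real (Suc k)))" using small[of g k] by blast
    have near: "d (limit_path (S h)) c < e / 2" if "\<forall>i<Suc k. h i = g i" for h
    proof -
      obtain y where y: "y \<in> U h (Suc k)" "d (limit_path (S h)) y < e / 4"
        using limit_path_approximated[of d "S h" "U h" "e / 4" "Suc k", OF ms compl finer ext len dec ne small e4]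
        by blast
      then have "y \<in> mball c (inverse (real (Suc k)))" using c local[OF that] by blast
      then have "d y c < e / 4" using k commute[of y c] by simp
      then show ?thesis using y(2) triangle[of "limit_path (S h)" y c] by simp
    qed
    have "limit_path (S h) \<in> mball (limit_path (S g)) e" if "h \<in> cyl (map g [0..<Suc k])" for h
    proof -
      have "d (limit_path (S h)) c < e / 2" "d (limit_path (S g)) c < e / 2"
        using near[of h] near[of g] that unfolding cyl_map by simp_all
      then show ?thesis
        using triangle[of "limit_path (S g)" c "limit_path (S h)"] commute[of c "limit_path (S h)"] by simp
    qed
    moreover have "g \<in> cyl (map g [0..<Suc k])" unfolding cyl_map by simp
    ultimately show "\<exists>V. openin cantor_space V \<and> g \<in> V \<and> (\<forall>h\<in>V. limit_path (S h) \<in> mball (limit_path (S g)) e)"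
      using openin_cyl by blast
  qed
qed

subsection \<open>Fusion\<close>

lemma sparse_tree_append:
  "(s, t) \<in> sparse_tree sL tL \<Longrightarrow> (s @ v, t @ v) \<in> sparse_tree sL tL"
proof (induction v rule: rev_induct)
  case (snoc b v)
  then show ?case
    using sparse_tree_snoc[of "s @ v" b "t @ v" b] by simp
qed simp

definition diff_labels :: "(nat \<Rightarrow> nat) \<Rightarrow> bool list \<Rightarrow> bool list \<Rightarrow> nat set" where
  "diff_labels lab s t = {lab l | l. l < length s \<and> s ! l \<noteq> t ! l}"

lemma diff_labels_snoc:
  assumes "length s = length t"
  shows "diff_labels lab (s @ [a]) (t @ [b]) =
    diff_labels lab s t \<union> (if a \<noteq> b then {lab (length s)} else {})"
proof (rule set_eqI)
  fix k
  have "k \<in> diff_labels lab (s @ [a]) (t @ [b]) \<longleftrightarrow>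
    (\<exists>l<length s. k = lab l \<and> s ! l \<noteq> t ! l) \<or> (k = lab (length s) \<and> a \<noteq> b)"
    unfolding diff_labels_def mem_Collect_eq
    using assms by (simp add: nth_append less_Suc_eq conj_disj_distribR ex_disj_distrib cong: conj_cong) blast
  then show "k \<in> diff_labels lab (s @ [a]) (t @ [b]) \<longleftrightarrow>
    k \<in> diff_labels lab s t \<union> (if a \<noteq> b then {lab (length s)} else {})"
    unfolding diff_labels_def by (cases "a = b"; simp; blast)
qed

lemma diff_labels_append:
  "length s = length t \<Longrightarrow> diff_labels lab (s @ v) (t @ v) = diff_labels lab s t"
proof (induction v rule: rev_induct)
  case (snoc b v)
  then show ?case
    using diff_labels_snoc[of "s @ v" "t @ v" lab b b] by simp
qed simp

text \<open>A stage of the fusion: initial segments of the two branches, and for each a set from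
  which points approximating the branch are drawn.\<close>

type_synonym state = "bool list \<times> bool list \<times> (nat \<Rightarrow> bool) set \<times> (nat \<Rightarrow> bool) set"

fun good :: "(bool list \<times> bool list) set \<Rightarrow> state \<Rightarrow> bool" where
  "good T (s, t, U, V) \<longleftrightarrow> (s, t) \<in> T \<and> length s = length t \<and> big s U \<and> big t V"

text \<open>Step k of the fusion: the bit b decides whether label k is realised by a difference, and
  each set enters one piece of the k-th cover, later a small ball.\<close>

fun refines :: "(nat \<Rightarrow> nat) \<Rightarrow> (nat \<Rightarrow> nat \<Rightarrow> (nat \<Rightarrow> bool) set) \<Rightarrow> (nat \<Rightarrow> nat \<Rightarrow> (nat \<Rightarrow> bool) set) \<Rightarrow>
    nat \<Rightarrow> bool \<Rightarrow> state \<Rightarrow> state \<Rightarrow> bool" where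
  "refines lab A B k b (s, t, U, V) (s', t', U', V') \<longleftrightarrow>
     (\<exists>v. s' = s @ v) \<and> (\<exists>v. t' = t @ v) \<and> length s < length s' \<and>
     U' \<subseteq> U \<and> V' \<subseteq> V \<and> (\<exists>i. U' \<subseteq> A k i) \<and> (\<exists>j. V' \<subseteq> B k j) \<and>
     diff_labels lab s' t' = diff_labels lab s t \<union> (if b then {k} else {})"

text \<open>Density extends both sequences by a common w to a prescribed pair with label k, where
  the bits 0 and b may follow. Common tails after that keep the pair in the tree and create no
  further differences.\<close>

lemma good_refinement:
  assumes dense: "\<And>s t k. length s = length t \<Longrightarrow>
      \<exists>w. sL (length (s @ w)) = s @ w \<and> tL (length (s @ w)) = t @ w \<and> lab (length (s @ w)) = k"
    and A: "\<And>n. (\<Union>i. A n i) = UNIV" and B: "\<And>n. (\<Union>i. B n i) = UNIV"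
    and q: "good (sparse_tree sL tL) q"
  shows "\<exists>q'. good (sparse_tree sL tL) q' \<and> refines lab A B k b q q'"
proof -
  obtain s t U V where q_eq: "q = (s, t, U, V)" by (cases q)
  have st: "(s, t) \<in> sparse_tree sL tL" "length s = length t" "big s U" "big t V"
    using q by (simp_all add: q_eq)
  obtain w where w: "sL (length (s @ w)) = s @ w" "tL (length (s @ w)) = t @ w" "lab (length (s @ w)) = k"
    using dense[OF st(2)] by blast
  have "(s @ w @ [False], t @ w @ [b]) \<in> sparse_tree sL tL"
    using sparse_tree_snoc[of "s @ w" False "t @ w" b sL tL] sparse_tree_append[OF st(1), of w] w by simp
  then have T: "(s @ w @ [False] @ v, t @ w @ [b] @ v) \<in> sparse_tree sL tL" for v
    using sparse_tree_append[of "s @ w @ [False]" "t @ w @ [b]" sL tL v] by simp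
  have diff: "diff_labels lab (s @ w @ [False] @ v) (t @ w @ [b] @ v) = diff_labels lab s t \<union> (if b then {k} else {})" for v
    using diff_labels_append[of "s @ w @ [False]" "t @ w @ [b]" lab v]
      diff_labels_snoc[of "s @ w" "t @ w" lab False b] diff_labels_append[of s t lab w] st(2) w(3) by simp
  obtain i v where U: "big ((s @ w @ [False]) @ v) (U \<inter> A k i)"
    using big_cover[OF big_append[OF st(3)] A] by blast
  \<comment> \<open>V is treated after the tail v found for U. Both sequences then receive the tail
    \<open>v @ v'\<close>, and bigness of the first set survives the extension by v'.\<close>
  obtain j v' where V: "big ((t @ w @ [b] @ v) @ v') (V \<inter> B k j)"
    using big_cover[OF big_append[OF st(4)] B] by blast
  let ?q = "(s @ w @ [False] @ v @ v', t @ w @ [b] @ v @ v', U \<inter> A k i, V \<inter> B k j)"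
  have "good (sparse_tree sL tL) ?q"
    using T[of "v @ v'"] st(2) big_append[OF U, of v'] V by simp
  moreover have "refines lab A B k b q ?q"
    using diff[of "v @ v'"] unfolding q_eq by auto
  ultimately show ?thesis by blast
qed

lemma fusion:
  assumes "\<And>s t k. length s = length t \<Longrightarrow>
      \<exists>w. sL (length (s @ w)) = s @ w \<and> tL (length (s @ w)) = t @ w \<and> lab (length (s @ w)) = k"
    and "\<And>n. (\<Union>i. A n i) = UNIV" and "\<And>n. (\<Union>i. B n i) = UNIV"
  obtains Q :: "(nat \<Rightarrow> bool) \<Rightarrow> nat \<Rightarrow> state"
  where "\<And>g. Q g 0 = ([], [], UNIV, UNIV)"
    and "\<And>g n. good (sparse_tree sL tL) (Q g n)"
    and "\<And>g n. refines lab A B n (g n) (Q g n) (Q g (Suc n))"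
    and "\<And>g h n. \<forall>i<n. g i = h i \<Longrightarrow> Q g n = Q h n"
proof -
  \<comment> \<open>The choice is a function of k, b and the state alone, so stage n depends only on
    the first n bits of g; continuity of the limit maps rests on this.\<close>
  define step where "step k b q = (SOME q'. good (sparse_tree sL tL) q' \<and> refines lab A B k b q q')" for k b q
  have step: "good (sparse_tree sL tL) (step k b q)" "refines lab A B k b q (step k b q)"
    if "good (sparse_tree sL tL) q" for k b q
    using someI_ex[OF good_refinement[where sL = sL and tL = tL and lab = lab and A = A and B = B, OF assms that, of k b]]
    unfolding step_def by blast+
  define Q where "Q g = rec_nat ([], [], UNIV, UNIV) (\<lambda>k. step k (g k))" for g
  have Q: "Q g 0 = ([], [], UNIV, UNIV)" "Q g (Suc n) = step n (g n) (Q g n)" for g n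
    by (simp_all add: Q_def)
  have good: "good (sparse_tree sL tL) (Q g n)" for g n
  proof (induction n)
    case 0
    have "([], []) \<in> sparse_tree sL tL" by (simp add: sparse_tree_def)
    then show ?case by (simp add: Q big_UNIV)
  qed (simp add: Q step)
  show thesis
  proof
    show "Q g n = Q h n" if "\<forall>i<n. g i = h i" for g h n
      using that by (induction n) (simp_all add: Q)
    show "refines lab A B n (g n) (Q g n) (Q g (Suc n))" for g n
      using step(2)[OF good] by (simp add: Q)
  qed (rule Q good)+
qed

text \<open>The fusion limits f and h form a map into the body, continuous for the finer topologies,
  whose set of difference labels at g is g itself. Pulling the set back along it gives the hard set,
  which is not in the dual class.\<close>

lemma not_pot_Pi0_cls:
  assumes dense: "\<And>s t k. length s = length t \<Longrightarrow>
      \<exists>w. sL (length (s @ w)) = s @ w \<and> tL (length (s @ w)) = t @ w \<and> lab (length (s @ w)) = k"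
    and r: "Well_order r"
  shows "\<not> pot (\<lambda>Z. Pi0_cls Z r) cantor_space cantor_space
    {(\<alpha>, \<beta>) \<in> body (sparse_tree sL tL). hard r (decode (\<lambda>k. \<exists>l. lab l = k \<and> \<alpha> l \<noteq> \<beta> l))}"
    (is "\<not> pot _ _ _ ?S")
proof
  assume "pot (\<lambda>Z. Pi0_cls Z r) cantor_space cantor_space ?S"
  then obtain \<sigma> \<tau> where st: "Polish_space \<sigma>" "Polish_space \<tau>" "finer_topology \<sigma> cantor_space"
    "finer_topology \<tau> cantor_space" and Pi: "Pi0_cls (prod_topology \<sigma> \<tau>) r ?S"
    unfolding pot_def by blast
  have metric: "\<exists>d. Metric_space UNIV d \<and> Metric_space.mcomplete UNIV d \<and> X = Metric_space.mtopology UNIV d"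
    if "Polish_space X" "finer_topology X cantor_space" for X
  proof -
    obtain M d where d: "Metric_space M d" "Metric_space.mcomplete M d" "X = Metric_space.mtopology M d"
      using \<open>Polish_space X\<close> unfolding Polish_space_def completely_metrizable_space_def by blast
    \<comment> \<open>A finer topology has the same points as Cantor space.\<close>
    then have "M = UNIV"
      using \<open>finer_topology X cantor_space\<close> Metric_space.topspace_mtopology[OF d(1)]
      unfolding finer_topology_def by simp
    then show ?thesis using d by blast
  qed
  obtain d1 where d1: "Metric_space UNIV d1" "Metric_space.mcomplete UNIV d1" "\<sigma> = Metric_space.mtopology UNIV d1"
    using metric[OF st(1,3)] by blast
  obtain d2 where d2: "Metric_space UNIV d2" "Metric_space.mcomplete UNIV d2" "\<tau> = Metric_space.mtopology UNIV d2"
    using metric[OF st(2,4)] by blast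
  obtain c1 where c1: "\<And>e. e > 0 \<Longrightarrow> (\<Union>i::nat. Metric_space.mball UNIV d1 (c1 i) e) = UNIV"
    using small_ball_cover[OF d1(1)] st(1) unfolding Polish_space_def d1(3) by blast
  obtain c2 where c2: "\<And>e. e > 0 \<Longrightarrow> (\<Union>i::nat. Metric_space.mball UNIV d2 (c2 i) e) = UNIV"
    using small_ball_cover[OF d2(1)] st(2) unfolding Polish_space_def d2(3) by blast
  define A where "A n i = Metric_space.mball UNIV d1 (c1 i) (inverse (real (Suc n)))" for n i
  define B where "B n i = Metric_space.mball UNIV d2 (c2 i) (inverse (real (Suc n)))" for n i
  have cover: "(\<Union>i. A n i) = UNIV" "(\<Union>i. B n i) = UNIV" for n
    unfolding A_def B_def by (intro c1 c2; simp)+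
  obtain Q :: "(nat \<Rightarrow> bool) \<Rightarrow> nat \<Rightarrow> state"
    where Q0: "\<And>g. Q g 0 = ([], [], UNIV, UNIV)"
    and Qgood: "\<And>g n. good (sparse_tree sL tL) (Q g n)"
    and Qstep: "\<And>g n. refines lab A B n (g n) (Q g n) (Q g (Suc n))"
    and Qlocal: "\<And>g h n. \<forall>i<n. g i = h i \<Longrightarrow> Q g n = Q h n"
    using fusion[of sL tL lab A B, OF dense cover] by blast
  define S where "S g n = fst (Q g n)" for g n
  define T where "T g n = fst (snd (Q g n))" for g n
  define U where "U g n = fst (snd (snd (Q g n)))" for g n
  define V where "V g n = snd (snd (snd (Q g n)))" for g n
  have Q_eq: "Q g n = (S g n, T g n, U g n, V g n)" for g n
    by (simp add: S_def T_def U_def V_def)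
  have good: "(S g n, T g n) \<in> sparse_tree sL tL" "length (S g n) = length (T g n)"
    "big (S g n) (U g n)" "big (T g n) (V g n)" for g n
    using Qgood[of g n] by (simp_all add: Q_eq)
  have step: "\<exists>v. S g (Suc n) = S g n @ v" "\<exists>v. T g (Suc n) = T g n @ v" "length (S g n) < length (S g (Suc n))"
    "U g (Suc n) \<subseteq> U g n" "V g (Suc n) \<subseteq> V g n" "\<exists>i. U g (Suc n) \<subseteq> A n i" "\<exists>i. V g (Suc n) \<subseteq> B n i"
    "diff_labels lab (S g (Suc n)) (T g (Suc n)) = diff_labels lab (S g n) (T g n) \<union> (if g n then {n} else {})" for g n
    using Qstep[of n g] unfolding Q_eq refines.simps by blast+
  have lenS: "n \<le> length (S g n)" for g n
  proof (induction n)
    case (Suc n)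
    then show ?case using step(3)[of g n] by linarith
  qed simp
  then have lenT: "n \<le> length (T g n)" for g n
    using good(2) by metis
  \<comment> \<open>Step k alone decides about label k, so after n steps the labels below n are
    settled and no other label has occurred.\<close>
  have diff: "diff_labels lab (S g n) (T g n) = {k. k < n \<and> g k}" for g n
  proof (induction n)
    case 0
    show ?case by (simp add: S_def T_def Q0 diff_labels_def)
  next
    case (Suc n)
    then show ?case unfolding step(8) by (auto simp: less_Suc_eq)
  qed
  define f where "f g = limit_path (S g)" for g
  define h where "h g = limit_path (T g)" for g
  have f_cyl: "f g \<in> cyl (S g n)" for g n
    unfolding f_def by (rule limit_path_in_cyl) (rule step lenS)+
  have h_cyl: "h g \<in> cyl (T g n)" for g n
    unfolding h_def by (rule limit_path_in_cyl) (rule step lenT)+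
  have "continuous_map cantor_space \<sigma> f"
    unfolding d1(3) f_def
  proof (rule continuous_map_limit_path[OF d1(1,2), where U = U])
    show "finer_topology (Metric_space.mtopology UNIV d1) cantor_space" using st(3) d1(3) by simp
    show "U g n \<inter> cyl (S g n) \<noteq> {}" for g n using good(3) by (rule big_nonempty)
    show "\<exists>c. U g (Suc n) \<subseteq> Metric_space.mball UNIV d1 c (inverse (real (Suc n)))" for g n
      using step(6)[of g n] unfolding A_def by blast
    show "U g n = U h n" if "\<forall>i<n. g i = h i" for g h n using Qlocal[OF that] by (simp add: U_def)
  qed (rule step lenS)+
  moreover have "continuous_map cantor_space \<tau> h"
    unfolding d2(3) h_def
  proof (rule continuous_map_limit_path[OF d2(1,2), where U = V])
    show "finer_topology (Metric_space.mtopology UNIV d2) cantor_space" using st(4) d2(3) by simp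
    show "V g n \<inter> cyl (T g n) \<noteq> {}" for g n using good(4) by (rule big_nonempty)
    show "\<exists>c. V g (Suc n) \<subseteq> Metric_space.mball UNIV d2 c (inverse (real (Suc n)))" for g n
      using step(7)[of g n] unfolding B_def by blast
    show "V g n = V h n" if "\<forall>i<n. g i = h i" for g h n using Qlocal[OF that] by (simp add: V_def)
  qed (rule step lenT)+
  ultimately have cont: "continuous_map cantor_space (prod_topology \<sigma> \<tau>) (\<lambda>g. (f g, h g))"
    by (simp add: continuous_map_pairedI)
  have "(f g, h g) \<in> body (sparse_tree sL tL)" for g
  proof -
    have "(map (f g) [0..<p], map (h g) [0..<p]) \<in> sparse_tree sL tL" for p
    proof -
      have len: "p \<le> length (S g p)" "p \<le> length (T g p)" using lenS lenT by auto
      have "map (f g) [0..<p] = take p (S g p)"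
        using len by (intro nth_equalityI) (simp_all add: cyl_nth[OF f_cyl[of g p]])
      moreover have "map (h g) [0..<p] = take p (T g p)"
        using len by (intro nth_equalityI) (simp_all add: cyl_nth[OF h_cyl[of g p]])
      moreover have "(take p (S g p), take p (T g p)) \<in> sparse_tree sL tL"
        using is_tree22_sparse_tree good(1) len unfolding is_tree22_def by blast
      ultimately show ?thesis by simp
    qed
    then show ?thesis by (simp add: body_def)
  qed
  moreover have "(\<lambda>k. \<exists>l. lab l = k \<and> f g l \<noteq> h g l) = g" for g
  proof
    fix k
    \<comment> \<open>Differences of the limits can be read off the finite stages: position l is
      present at stage l + 1, and label k is settled at stage k + 1.\<close>
    have mem: "lab l \<in> diff_labels lab (S g n) (T g n) \<or> f g l = h g l" if "l < length (S g n)" for l n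
      using cyl_nth[OF f_cyl that] cyl_nth[OF h_cyl, of l g n] that good(2)[of g n]
      by (auto simp: diff_labels_def)
    show "(\<exists>l. lab l = k \<and> f g l \<noteq> h g l) = g k"
    proof
      assume "\<exists>l. lab l = k \<and> f g l \<noteq> h g l"
      then obtain l where l: "lab l = k" "f g l \<noteq> h g l" by blast
      have "l < length (S g (Suc l))" using lenS[of "Suc l" g] by simp
      then have "k \<in> diff_labels lab (S g (Suc l)) (T g (Suc l))" using mem l by blast
      then show "g k" by (simp add: diff)
    next
      assume "g k"
      then have "k \<in> diff_labels lab (S g (Suc k)) (T g (Suc k))" by (simp add: diff)
      then obtain l where l: "lab l = k" "l < length (S g (Suc k))" "S g (Suc k) ! l \<noteq> T g (Suc k) ! l"
        by (auto simp: diff_labels_def)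
      then have "f g l \<noteq> h g l"
        using cyl_nth[OF f_cyl l(2)] cyl_nth[OF h_cyl, of l g "Suc k"] good(2)[of g "Suc k"] by simp
      then show "\<exists>l. lab l = k \<and> f g l \<noteq> h g l" using l(1) by blast
    qed
  qed
  ultimately have "{g \<in> topspace cantor_space. (f g, h g) \<in> ?S} = {g. hard r (decode g)}"
    by simp
  then have "Pi0_cls cantor_space r {g. hard r (decode g)}"
    using Pi0_cls_preimage[OF Pi cont] by simp
  then show False using not_Pi0_cls_hard[OF r] by blast
qed

section \<open>The prescribed pairs and the conclusion\<close>

lemma dense_enumeration:
  "\<exists>sL tL lab. \<forall>s t :: bool list. length s = length t \<longrightarrow> (\<forall>k::nat.
      \<exists>w. sL (length (s @ w)) = s @ w \<and> tL (length (s @ w)) = t @ w \<and> lab (length (s @ w)) = k)"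
proof -
  define dec where "dec l = (from_nat (fst (prod_decode l)) :: bool list \<times> bool list \<times> nat)" for l
  define pad where "pad l s = s @ replicate (l - length s) False" for l and s :: "bool list"
  define sL where "sL l = pad l (fst (dec l))" for l
  define tL where "tL l = pad l (fst (snd (dec l)))" for l
  define lab where "lab l = snd (snd (dec l))" for l
  have "\<exists>w. sL (length (s @ w)) = s @ w \<and> tL (length (s @ w)) = t @ w \<and> lab (length (s @ w)) = k"
    if len: "length s = length t" for s t k
  proof -
    \<comment> \<open>Pairing the code of the triple with \<open>length s\<close> makes l at least
      \<open>length s\<close>, so padding s and t with zeros gives extensions of length exactly
      l.\<close>
    define l where "l = prod_encode (to_nat (s, t, k), length s)"
    have l: "length s \<le> l" unfolding l_def by (rule le_prod_encode_2)
    have dec: "dec l = (s, t, k)" by (simp add: dec_def l_def)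
    show ?thesis
      by (rule exI[of _ "replicate (l - length s) False"]) (use l len in \<open>simp add: sL_def tL_def lab_def dec pad_def\<close>)
  qed
  then show ?thesis
    by (rule_tac exI[of _ sL], rule_tac exI[of _ tL], rule_tac exI[of _ lab]) simp
qed

theorem theorem1p11:
  shows "\<exists>T. is_tree22 T \<and> acyclic_levels T \<and>
    (\<forall>r :: nat rel. Well_order r \<longrightarrow>
       (\<exists>S. Sigma0_cls (subtopology (prod_topology cantor_space cantor_space) (body T)) r S \<and>
            \<not> pot (\<lambda>Z. Pi0_cls Z r) cantor_space cantor_space S))"
proof -
  obtain sL tL :: "nat \<Rightarrow> bool list" and lab :: "nat \<Rightarrow> nat" where dense:
    "\<And>s t k. length s = length t \<Longrightarrow>
      \<exists>w. sL (length (s @ w)) = s @ w \<and> tL (length (s @ w)) = t @ w \<and> lab (length (s @ w)) = k"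
    using dense_enumeration by metis
  let ?T = "sparse_tree sL tL"
  let ?X = "subtopology (prod_topology cantor_space cantor_space) (body ?T)"
  let ?D = "\<lambda>z. decode (\<lambda>k. \<exists>l. lab l = k \<and> fst z l \<noteq> snd z l)"
  have "\<exists>S. Sigma0_cls ?X r S \<and> \<not> pot (\<lambda>Z. Pi0_cls Z r) cantor_space cantor_space S" if r: "Well_order r" for r
  proof -
    have X: "topspace ?X = body ?T" by simp
    \<comment> \<open>This condition asks for a difference at some position labelled
      \<open>to_nat p\<close>, a union of conditions on single coordinates, hence open.\<close>
    have "openin ?X {z \<in> topspace ?X. ?D z p}" for p
    proof -
      have "openin (prod_topology cantor_space cantor_space) {z. fst z l \<noteq> snd z l}" for l
      proof -
        have "{z. fst z l \<noteq> snd z l} = {x::nat \<Rightarrow> bool. x l} \<times> {y. \<not> y l} \<union> {x. \<not> x l} \<times> {y::nat \<Rightarrow> bool. y l}"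
          by auto
        then show ?thesis
          by (simp add: openin_cantor_coord openin_prod_Times_iff openin_Un)
      qed
      then have "openin (prod_topology cantor_space cantor_space) (\<Union>l\<in>{l. lab l = to_nat p}. {z. fst z l \<noteq> snd z l})"
        by (intro openin_Union) auto
      then have "openin ?X ((\<Union>l\<in>{l. lab l = to_nat p}. {z. fst z l \<noteq> snd z l}) \<inter> body ?T)"
        by (rule openin_subtopology_Int)
      also have "(\<Union>l\<in>{l. lab l = to_nat p}. {z. fst z l \<noteq> snd z l}) \<inter> body ?T = {z \<in> topspace ?X. ?D z p}"
        unfolding X decode_def by (rule set_eqI) (simp only: mem_Collect_eq Int_iff UN_iff bex_simps conj_commute Bex_def)
      finally show ?thesis .
    qed
    then have "Sigma0_cls ?X r {z \<in> topspace ?X. hard r (?D z)}"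
      by (rule Sigma0_cls_hard[OF r])
    moreover have "{z \<in> topspace ?X. hard r (?D z)} =
      {(\<alpha>, \<beta>) \<in> body ?T. hard r (decode (\<lambda>k. \<exists>l. lab l = k \<and> \<alpha> l \<noteq> \<beta> l))}"
      unfolding X by (simp only: case_prod_unfold prod.collapse)
    ultimately have "Sigma0_cls ?X r {(\<alpha>, \<beta>) \<in> body ?T. hard r (decode (\<lambda>k. \<exists>l. lab l = k \<and> \<alpha> l \<noteq> \<beta> l))}"
      by (simp only:)
    with not_pot_Pi0_cls[OF dense r] show ?thesis
      by (intro exI conjI)
  qed
  then show ?thesis
    using is_tree22_sparse_tree acyclic_levels_sparse_tree by blast
qed

end
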